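(* For any two signed complexes $G$ and $H$, the connection graph of the product is the strong product of the connection graphs: $(G\times H)' = G'\boxtimes H'$, where the cell $x\times y$ of $G\times H$ is identified with the pair $(x,y)$ of cells $x$ of $G$ and $y$ of $H$. (In particular this holds for any two finite abstract simplicial complexes $G,H$.)
   Context: A finite abstract simplicial complex is a finite set of finite non-empty sets which is closed under taking non-empty subsets. A product complex is a finite Cartesian product $G_1\times\cdots\times G_n$ ($n\ge 1$) of finite abstract simplicial complexes; its cells are the sets $x=x_1\times\cdots\times x_n$ with $x_i\in G_i$. A signed complex is a finite formal disjoint union of product complexes, each summand carrying a sign in $\{1,-1\}$; cells in different summands are regarded as disjoint. The product of signed complexes is taken term by term, signs being multiplied. The connection graph $G'$ of a product complex $G$ is the finite simple graph whose vertices are the cells of $G$, two different cells being adjacent if and only if they intersect as sets. For a signed complex, $G'$ is the disjoint union of the connection graphs of the summands, each carrying the sign of its summand (a signed graph). The strong product $A\boxtimes B$ of finite simple graphs $A=(V,E)$, $B=(W,F)$ has vertex set $V\times W$, and two distinct vertices $(a,b),(c,d)$ are adjacent iff ($a=c$ and $(b,d)\in F$) or ($b=d$ and $(a,c)\in E$) or ($(a,c)\in E$ and $(b,d)\in F$). It is extended to signed graphs term by term, with signs multiplied. *)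

theory Defs
  imports Main
begin

definition simplicial_complex :: "'a set set \<Rightarrow> bool" where
  "simplicial_complex K \<longleftrightarrow>
     finite K \<and>
     (\<forall>x\<in>K. finite x \<and> x \<noteq> {}) \<and>
     (\<forall>x\<in>K. \<forall>y. y \<subseteq> x \<and> y \<noteq> {} \<longrightarrow> y \<in> K)"

text \<open>
  A product complex is given by the list of its factors. Points of an n-fold Cartesian product
  are lists of length n, and \<^const>\<open>listset\<close> sends a list of sets to their Cartesian product.
  In \<open>product_cells\<close> the inner \<^const>\<open>listset\<close> ranges over all choices of one simplex from each
  factor; the outer one forms the Cartesian product of the chosen simplices.
\<close>

definition product_complex :: "'a set set list \<Rightarrow> bool" where
  "product_complex Gs \<longleftrightarrow> Gs \<noteq> [] \<and> (\<forall>K\<in>set Gs. simplicial_complex K)"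

definition product_cells :: "'a set set list \<Rightarrow> 'a list set set" where
  "product_cells Gs = listset ` listset Gs"

text \<open>Cartesian product of two cells, with the pair of points \<open>(u, v)\<close> read as \<open>u @ v\<close>.\<close>

definition cell_times :: "'a list set \<Rightarrow> 'a list set \<Rightarrow> 'a list set" where
  "cell_times x y = (\<lambda>(u, v). u @ v) ` (x \<times> y)"

record 'v graph =
  verts :: "'v set"
  edges :: "'v set set"

definition simple_graph :: "'v graph \<Rightarrow> bool" where
  "simple_graph A \<longleftrightarrow>
     finite (verts A) \<and>
     edges A \<subseteq> {{u, v} | u v. u \<in> verts A \<and> v \<in> verts A \<and> u \<noteq> v}"

definition connection_graph :: "'p set set \<Rightarrow> 'p set graph" where
  "connection_graph C =
     \<lparr> verts = C,
       edges = {{x, y} | x y. x \<in> C \<and> y \<in> C \<and> x \<noteq> y \<and> x \<inter> y \<noteq> {}} \<rparr>"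

definition strong_product :: "'v graph \<Rightarrow> 'w graph \<Rightarrow> ('v \<times> 'w) graph" where
  "strong_product A B =
     \<lparr> verts = verts A \<times> verts B,
       edges = {{(a, b), (c, d)} | a b c d.
         (a, b) \<in> verts A \<times> verts B \<and> (c, d) \<in> verts A \<times> verts B \<and> (a, b) \<noteq> (c, d) \<and>
         ((a = c \<and> {b, d} \<in> edges B) \<or>
          (b = d \<and> {a, c} \<in> edges A) \<or>
          ({a, c} \<in> edges A \<and> {b, d} \<in> edges B))} \<rparr>"

definition graph_iso :: "('v \<Rightarrow> 'w) \<Rightarrow> 'v graph \<Rightarrow> 'w graph \<Rightarrow> bool" where
  "graph_iso f A B \<longleftrightarrow>
     bij_betw f (verts A) (verts B) \<and> edges B = (\<lambda>e. f ` e) ` edges A"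

text \<open>
  A finite formal disjoint union of signed objects is a family over a finite index set, so the
  same object may occur in several summands. Values of \<open>sign\<close> and \<open>summand\<close> outside \<open>terms\<close> are
  irrelevant.
\<close>

record ('i, 'x) signed_union =
  terms :: "'i set"
  sign :: "'i \<Rightarrow> int"
  summand :: "'i \<Rightarrow> 'x"

definition signed_map :: "('x \<Rightarrow> 'y) \<Rightarrow> ('i, 'x) signed_union \<Rightarrow> ('i, 'y) signed_union" where
  "signed_map f A = \<lparr> terms = terms A, sign = sign A, summand = (\<lambda>i. f (summand A i)) \<rparr>"

definition signed_product ::
    "('x \<Rightarrow> 'y \<Rightarrow> 'z) \<Rightarrow> ('i, 'x) signed_union \<Rightarrow> ('j, 'y) signed_union \<Rightarrow>
     ('i \<times> 'j, 'z) signed_union" where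
  "signed_product f A B =
     \<lparr> terms = terms A \<times> terms B,
       sign = (\<lambda>(i, j). sign A i * sign B j),
       summand = (\<lambda>(i, j). f (summand A i) (summand B j)) \<rparr>"

type_synonym ('i, 'a) signed_complex = "('i, 'a set set list) signed_union"
type_synonym ('i, 'v) signed_graph = "('i, 'v graph) signed_union"

definition is_signed_complex :: "('i, 'a) signed_complex \<Rightarrow> bool" where
  "is_signed_complex G \<longleftrightarrow>
     finite (terms G) \<and>
     (\<forall>i\<in>terms G. sign G i \<in> {1, -1} \<and> product_complex (summand G i))"

definition complex_times ::
    "('i, 'a) signed_complex \<Rightarrow> ('j, 'a) signed_complex \<Rightarrow> ('i \<times> 'j, 'a) signed_complex" where
  "complex_times = signed_product (@)"

definition signed_connection_graph ::
    "('i, 'a) signed_complex \<Rightarrow> ('i, 'a list set) signed_graph" where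
  "signed_connection_graph = signed_map (\<lambda>Gs. connection_graph (product_cells Gs))"

definition signed_strong_product ::
    "('i, 'v) signed_graph \<Rightarrow> ('j, 'w) signed_graph \<Rightarrow> ('i \<times> 'j, 'v \<times> 'w) signed_graph" where
  "signed_strong_product = signed_product strong_product"

definition signed_graph_iso ::
    "('v \<Rightarrow> 'w) \<Rightarrow> ('i, 'v) signed_graph \<Rightarrow> ('i, 'w) signed_graph \<Rightarrow> bool" where
  "signed_graph_iso f A B \<longleftrightarrow>
     terms A = terms B \<and>
     (\<forall>i\<in>terms A. sign A i = sign B i \<and> graph_iso f (summand A i) (summand B i))"

lemma finite_listset: "(\<And>A. A \<in> set As \<Longrightarrow> finite A) \<Longrightarrow> finite (listset As)"
proof (induction As)
  case (Cons A As)
  then have "finite ((\<lambda>(x, xs). x # xs) ` (A \<times> listset As))" by auto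
  moreover have "listset (A # As) = (\<lambda>(x, xs). x # xs) ` (A \<times> listset As)"
    by (auto simp: set_Cons_def)
  ultimately show ?case by simp
qed simp

lemma finite_product_cells: "product_complex Gs \<Longrightarrow> finite (product_cells Gs)"
  unfolding product_complex_def product_cells_def simplicial_complex_def
  by (intro finite_imageI finite_listset) auto

lemma simple_graph_connection_graph: "finite C \<Longrightarrow> simple_graph (connection_graph C)"
  unfolding simple_graph_def connection_graph_def by auto

lemma simple_graph_strong_product:
  assumes "simple_graph A" "simple_graph B"
  shows "simple_graph (strong_product A B)"
  using assms unfolding simple_graph_def strong_product_def
  by (simp only: graph.simps finite_cartesian_product) blast

end

theory Submission
  imports Defs
begin

text \<open>
  Two boxes \<open>x \<times> y\<close> and \<open>x' \<times> y'\<close> meet iff \<open>x\<close> meets \<open>x'\<close> and \<open>y\<close> meets \<open>y'\<close>. A nonempty set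
  meets itself, so for cells the relation \<open>x \<inter> x' \<noteq> {}\<close> is exactly ``equal or adjacent in the
  connection graph''. The strong product is the graph product whose ``equal or adjacent''
  relation is the conjunction of those of its factors: its three clauses are this conjunction
  with the case of two equal pairs removed. Hence the two edge relations agree. Nonemptiness
  also lets a box determine its sides, so the identification of the vertices is a bijection.

  All of this survives when the pairs of points are renamed by an injective map. The lemma
  \<open>graph_iso_strong_product_connection_graph\<close> is therefore stated for an arbitrary such renaming
  and used twice: with the identity for two simplicial complexes, and with concatenation of lists
  for two product complexes. Concatenation loses information in general, but all points of a
  product complex have as many coordinates as there are factors, so the place of the cut is
  known. A signed complex is then treated summand by summand.
\<close>

lemma edge_connection_graph_iff:
  "{x, y} \<in> edges (connection_graph C) \<longleftrightarrow> x \<in> C \<and> y \<in> C \<and> x \<noteq> y \<and> x \<inter> y \<noteq> {}"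
  unfolding connection_graph_def by (auto simp: doubleton_eq_iff)

text \<open>
  The form in which the three clauses of the strong product are a single condition. The empty set
  has to be excluded because it is equal to itself without meeting itself.
\<close>

lemma edges_strong_product_connection_graph:
  assumes "{} \<notin> C" "{} \<notin> D"
  shows "edges (strong_product (connection_graph C) (connection_graph D)) =
    {{(a, b), (c, d)} | a b c d. a \<in> C \<and> b \<in> D \<and> c \<in> C \<and> d \<in> D \<and> (a, b) \<noteq> (c, d) \<and>
       a \<inter> c \<noteq> {} \<and> b \<inter> d \<noteq> {}}"
proof -
  have V: "verts (connection_graph C) = C" "verts (connection_graph D) = D"
    by (simp_all add: connection_graph_def)
  have "((a, b) \<in> C \<times> D \<and> (c, d) \<in> C \<times> D \<and> (a, b) \<noteq> (c, d) \<and>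
         ((a = c \<and> {b, d} \<in> edges (connection_graph D)) \<or>
          (b = d \<and> {a, c} \<in> edges (connection_graph C)) \<or>
          ({a, c} \<in> edges (connection_graph C) \<and> {b, d} \<in> edges (connection_graph D)))) \<longleftrightarrow>
        (a \<in> C \<and> b \<in> D \<and> c \<in> C \<and> d \<in> D \<and> (a, b) \<noteq> (c, d) \<and> a \<inter> c \<noteq> {} \<and> b \<inter> d \<noteq> {})"
    for a b c d
    using assms unfolding edge_connection_graph_iff by (cases "a = c"; cases "b = d") auto
  then show ?thesis
    unfolding strong_product_def V by simp
qed

text \<open>
  The renaming \<open>p\<close> must be injective across all cells rather than on each box alone: comparing or
  intersecting the images of two boxes compares points of different boxes.
\<close>

lemma graph_iso_strong_product_connection_graph:
  fixes p :: "'a \<times> 'b \<Rightarrow> 'c"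
  assumes inj: "inj_on p (\<Union>C \<times> \<Union>D)"
    and ne: "{} \<notin> C" "{} \<notin> D"
  shows "graph_iso (\<lambda>(x, y). p ` (x \<times> y))
           (strong_product (connection_graph C) (connection_graph D))
           (connection_graph {p ` (x \<times> y) | x y. x \<in> C \<and> y \<in> D})"
proof -
  let ?f = "\<lambda>(x, y). p ` (x \<times> y)"
  let ?P = "{p ` (x \<times> y) | x y. x \<in> C \<and> y \<in> D}"
  have P: "?P = ?f ` (C \<times> D)" by auto
  have eq: "p ` (a \<times> b) = p ` (c \<times> d) \<longleftrightarrow> (a, b) = (c, d)"
    if "a \<in> C" "b \<in> D" "c \<in> C" "d \<in> D" for a b c d
  proof -
    have "p ` (a \<times> b) = p ` (c \<times> d) \<longleftrightarrow> a \<times> b = c \<times> d"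
      using that by (intro inj_on_image_eq_iff[OF inj]) auto
    moreover have "a \<noteq> {}" "b \<noteq> {}" using that ne by auto
    ultimately show ?thesis by (auto simp: times_eq_iff)
  qed
  have meet: "p ` (a \<times> b) \<inter> p ` (c \<times> d) \<noteq> {} \<longleftrightarrow> a \<inter> c \<noteq> {} \<and> b \<inter> d \<noteq> {}"
    if "a \<in> C" "b \<in> D" "c \<in> C" "d \<in> D" for a b c d
  proof -
    have "p ` (a \<times> b) \<inter> p ` (c \<times> d) = p ` ((a \<inter> c) \<times> (b \<inter> d))"
      using that by (subst inj_on_image_Int[OF inj, symmetric]) (auto simp: Times_Int_Times)
    then show ?thesis by auto
  qed
  have image_compr: "F ` {g a b c d | a b c d. Q a b c d} = {F (g a b c d) | a b c d. Q a b c d}"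
    for F :: "('a set \<times> 'b set) set \<Rightarrow> 'c set set" and g
      and Q :: "'a set \<Rightarrow> 'b set \<Rightarrow> 'a set \<Rightarrow> 'b set \<Rightarrow> bool"
    by blast
  have "bij_betw ?f (C \<times> D) ?P"
    unfolding P by (rule inj_on_imp_bij_betw) (auto simp: inj_on_def eq)
  moreover have "edges (connection_graph ?P) =
      (\<lambda>e. ?f ` e) ` edges (strong_product (connection_graph C) (connection_graph D))"
  proof -
    have "edges (connection_graph ?P) =
        {{p ` (a \<times> b), p ` (c \<times> d)} | a b c d. a \<in> C \<and> b \<in> D \<and> c \<in> C \<and> d \<in> D \<and>
           p ` (a \<times> b) \<noteq> p ` (c \<times> d) \<and> p ` (a \<times> b) \<inter> p ` (c \<times> d) \<noteq> {}}"
      unfolding connection_graph_def graph.simps by blast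
    also have "\<dots> = {?f ` {(a, b), (c, d)} | a b c d. a \<in> C \<and> b \<in> D \<and> c \<in> C \<and> d \<in> D \<and>
           (a, b) \<noteq> (c, d) \<and> a \<inter> c \<noteq> {} \<and> b \<inter> d \<noteq> {}}"
      by (intro Collect_cong ex_cong1) (simp add: eq meet cong: conj_cong)
    also have "\<dots> = (\<lambda>e. ?f ` e) `
        edges (strong_product (connection_graph C) (connection_graph D))"
      by (simp only: edges_strong_product_connection_graph[OF ne] image_compr)
    finally show ?thesis .
  qed
  ultimately show ?thesis
    unfolding graph_iso_def by (simp add: strong_product_def connection_graph_def)
qed

lemma cell_times_set_Cons: "cell_times (set_Cons A X) Y = set_Cons A (cell_times X Y)"
  unfolding cell_times_def set_Cons_def
  by (intro set_eqI) (simp add: image_iff Bex_def, metis append_Cons)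

lemma listset_append: "listset (As @ Bs) = cell_times (listset As) (listset Bs)"
proof (induction As)
  case Nil
  then show ?case by (force simp: cell_times_def)
next
  case (Cons A As)
  then show ?case by (simp add: cell_times_set_Cons)
qed

lemma length_listset: "xs \<in> listset As \<Longrightarrow> length xs = length As"
  by (induction As arbitrary: xs) (auto simp: set_Cons_def)

lemma listset_eq_empty_iff: "listset As = {} \<longleftrightarrow> {} \<in> set As"
  by (induction As) (auto simp: set_Cons_def)

lemma set_in_listset: "xs \<in> listset As \<Longrightarrow> set xs \<subseteq> \<Union>(set As)"
  by (induction As arbitrary: xs) (fastforce simp: set_Cons_def)+

text \<open>
  \<open>listset_append\<close> enters on two levels: a choice of simplices for \<open>Gs @ Hs\<close> is a choice for \<open>Gs\<close>
  followed by one for \<open>Hs\<close>, and the cell it spans is the product of the two cells.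
\<close>

lemma product_cells_append:
  "product_cells (Gs @ Hs) = {cell_times x y | x y. x \<in> product_cells Gs \<and> y \<in> product_cells Hs}"
proof -
  have choices: "listset (Gs @ Hs) = {us @ vs | us vs. us \<in> listset Gs \<and> vs \<in> listset Hs}"
    unfolding listset_append cell_times_def by auto
  have "product_cells (Gs @ Hs) =
      {listset (us @ vs) | us vs. us \<in> listset Gs \<and> vs \<in> listset Hs}"
    unfolding product_cells_def choices by blast
  also have "\<dots> = {cell_times (listset us) (listset vs) | us vs.
      us \<in> listset Gs \<and> vs \<in> listset Hs}"
    by (simp only: listset_append)
  also have "\<dots> = {cell_times x y | x y. x \<in> product_cells Gs \<and> y \<in> product_cells Hs}"
    unfolding product_cells_def by (intro Collect_cong) (simp add: image_iff Bex_def, metis)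
  finally show ?thesis .
qed

lemma length_point_product_cells: "u \<in> \<Union>(product_cells Gs) \<Longrightarrow> length u = length Gs"
  by (auto simp: product_cells_def dest!: length_listset)

lemma empty_notin_product_cells:
  assumes "product_complex Gs"
  shows "{} \<notin> product_cells Gs"
proof
  assume "{} \<in> product_cells Gs"
  then obtain xs where xs: "xs \<in> listset Gs" "{} \<in> set xs"
    unfolding product_cells_def by (metis imageE listset_eq_empty_iff)
  then have "{} \<in> \<Union>(set Gs)" using set_in_listset by blast
  then show False
    using assms by (auto simp: product_complex_def simplicial_complex_def)
qed

lemma graph_iso_product_complex:
  assumes "product_complex Gs" "product_complex Hs"
  shows "graph_iso (\<lambda>(x, y). cell_times x y)
           (strong_product (connection_graph (product_cells Gs))
              (connection_graph (product_cells Hs)))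
           (connection_graph (product_cells (Gs @ Hs)))"
proof -
  have "inj_on (\<lambda>(u, v). u @ v) (\<Union>(product_cells Gs) \<times> \<Union>(product_cells Hs))"
  proof (rule inj_onI, clarify)
    fix u v u' v' x x'
    assume "u \<in> x" "x \<in> product_cells Gs" "u' \<in> x'" "x' \<in> product_cells Gs"
    then have "length u = length u'"
      by (metis UnionI length_point_product_cells)
    moreover assume "u @ v = u' @ v'"
    ultimately show "u = u' \<and> v = v'" by simp
  qed
  from graph_iso_strong_product_connection_graph[OF this] assms show ?thesis
    unfolding product_cells_append cell_times_def by (simp add: empty_notin_product_cells)
qed

theorem lemma1:
  fixes G :: "('i, 'a) signed_complex" and H :: "('j, 'a) signed_complex"
  assumes "is_signed_complex G" and "is_signed_complex H"
  shows "signed_graph_iso (\<lambda>(x, y). cell_times x y)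
           (signed_strong_product (signed_connection_graph G) (signed_connection_graph H))
           (signed_connection_graph (complex_times G H)) \<and>
         (\<forall>(K :: 'b set set) (L :: 'c set set).
           simplicial_complex K \<longrightarrow> simplicial_complex L \<longrightarrow>
           graph_iso (\<lambda>(x, y). x \<times> y)
             (strong_product (connection_graph K) (connection_graph L))
             (connection_graph {x \<times> y | x y. x \<in> K \<and> y \<in> L}))"
proof (intro conjI allI impI)
  show "signed_graph_iso (\<lambda>(x, y). cell_times x y)
          (signed_strong_product (signed_connection_graph G) (signed_connection_graph H))
          (signed_connection_graph (complex_times G H))"
    using assms
    by (auto simp: signed_graph_iso_def signed_strong_product_def signed_connection_graph_def
        complex_times_def signed_product_def signed_map_def is_signed_complex_def
        intro: graph_iso_product_complex)
next
  fix K :: "'b set set" and L :: "'c set set"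
  assume "simplicial_complex K" "simplicial_complex L"
  then have "{} \<notin> K" "{} \<notin> L" by (auto simp: simplicial_complex_def)
  then show "graph_iso (\<lambda>(x, y). x \<times> y)
      (strong_product (connection_graph K) (connection_graph L))
      (connection_graph {x \<times> y | x y. x \<in> K \<and> y \<in> L})"
    using graph_iso_strong_product_connection_graph[of "\<lambda>z. z" K L] by simp
qed

end
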